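(* For all integers $n,i$ with $n\ge1$ and $0\le i\le n$, the polynomials $\mathsf{ADerExc}_{n,i}^{+}(t)$ and $\mathsf{ADerExc}_{n,i}^{-}(t)$ are gamma positive with center of symmetry $(n-i)/2$.
   Context: $\mathfrak{S}_n$ is the symmetric group on $[n]$, $\mathcal{A}_n$ its even permutations. $\mathfrak{SD}_{n,i}$ is the set of $\pi\in\mathfrak{S}_n$ with exactly $i$ fixed points, $\mathfrak{SD}_{n,i}^{+}=\mathfrak{SD}_{n,i}\cap\mathcal{A}_n$, $\mathfrak{SD}_{n,i}^{-}=\mathfrak{SD}_{n,i}\setminus\mathcal{A}_n$. $\mathsf{exc}(\pi)=|\{j:\pi_j>j\}|$ and $\mathsf{ADerExc}_{n,i}^{\pm}(t)=\sum_{\pi\in\mathfrak{SD}_{n,i}^{\pm}}t^{\mathsf{exc}(\pi)}$. A polynomial $f(t)$ is gamma positive with center of symmetry $c$ ($2c\in\mathbb{Z}$) if $f(t)=\sum_{j}\gamma_jt^j(1+t)^{2c-2j}$, summing over integers $0\le j\le c$, with all $\gamma_j\ge0$. *)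

theory Defs
  imports Complex_Main "HOL-Combinatorics.Permutations" "HOL-Computational_Algebra.Polynomial"
begin

definition symmetric_perms :: "nat \<Rightarrow> (nat \<Rightarrow> nat) set" where
  "symmetric_perms n = {p. p permutes {1..n}}"

definition alternating_perms :: "nat \<Rightarrow> (nat \<Rightarrow> nat) set" where
  "alternating_perms n = {p \<in> symmetric_perms n. evenperm p}"

text \<open>Fixed points are counted inside \<open>{1..n}\<close> only: as a function on \<open>nat\<close>, a permutation
  of \<open>{1..n}\<close> also fixes every number outside that set.\<close>

definition SD :: "nat \<Rightarrow> nat \<Rightarrow> (nat \<Rightarrow> nat) set" where
  "SD n i = {p \<in> symmetric_perms n. card {j \<in> {1..n}. p j = j} = i}"

definition SD_plus :: "nat \<Rightarrow> nat \<Rightarrow> (nat \<Rightarrow> nat) set" where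
  "SD_plus n i = SD n i \<inter> alternating_perms n"

definition SD_minus :: "nat \<Rightarrow> nat \<Rightarrow> (nat \<Rightarrow> nat) set" where
  "SD_minus n i = SD n i - alternating_perms n"

definition exc :: "nat \<Rightarrow> (nat \<Rightarrow> nat) \<Rightarrow> nat" where
  "exc n p = card {j \<in> {1..n}. p j > j}"

definition ADerExc_plus :: "nat \<Rightarrow> nat \<Rightarrow> real poly" where
  "ADerExc_plus n i = (\<Sum>p\<in>SD_plus n i. monom 1 (exc n p))"

definition ADerExc_minus :: "nat \<Rightarrow> nat \<Rightarrow> real poly" where
  "ADerExc_minus n i = (\<Sum>p\<in>SD_minus n i. monom 1 (exc n p))"

text \<open>The centre \<open>c\<close> is a half-integer. For \<open>j \<le> c\<close> the exponent \<open>2 * c - 2 * j\<close> is a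
  nonnegative integer, so \<open>floor\<close> and \<open>nat\<close> below only change its type.\<close>

definition gamma_positive :: "real poly \<Rightarrow> real \<Rightarrow> bool" where
  "gamma_positive f c \<longleftrightarrow> 2 * c \<in> \<int> \<and>
     (\<exists>\<gamma> :: nat \<Rightarrow> real. (\<forall>j. real j \<le> c \<longrightarrow> \<gamma> j \<ge> 0) \<and>
        f = (\<Sum>j | real j \<le> c.
               smult (\<gamma> j) (monom 1 j * [:1, 1:] ^ nat \<lfloor>2 * c - 2 * real j\<rfloor>)))"

end

theory Submission
  imports Defs
begin

text \<open>Inserting \<open>n + 1\<close> right after \<open>j\<close> into a cycle of a permutation \<open>q\<close> of \<open>{1..n}\<close> reverses the
  sign of \<open>q\<close>, and adds an excedance unless \<open>j\<close> is already one. Hence the polynomials of even and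
  of odd permutations of \<open>{1..n + 1}\<close> with \<open>i\<close> fixed points are obtained from those on \<open>{1..n}\<close> by
  three operations: adding \<open>n + 1\<close> as a fixed point, multiplying by \<open>(i + 1) t\<close> (insertion after a
  fixed point), and \<open>f \<mapsto> m t f + t (1 - t) f'\<close> with \<open>m = n - i\<close> (insertion after a non-fixed
  point). The last one maps \<open>t^j (1 + t)^(m - 2j)\<close> to
  \<open>j t^j (1 + t)^(m + 1 - 2j) + 2 (m - 2j) t^(j + 1) (1 + t)^(m - 1 - 2j)\<close>, so all three preserve
  nonnegativity of the gamma coefficients.\<close>

section \<open>Gamma positive polynomials\<close>

definition gamma_basis :: "nat \<Rightarrow> nat \<Rightarrow> real poly" where
  "gamma_basis m j = monom 1 j * [:1, 1:] ^ (m - 2 * j)"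

text \<open>The index m is twice the centre of symmetry, so that the induction stays in the natural
  numbers.\<close>

definition gamma_pos :: "nat \<Rightarrow> real poly \<Rightarrow> bool" where
  "gamma_pos m f \<longleftrightarrow> (\<exists>\<gamma>. (\<forall>j. \<gamma> j \<ge> 0) \<and> f = (\<Sum>j\<le>m div 2. smult (\<gamma> j) (gamma_basis m j)))"

lemma gamma_pos_0: "gamma_pos m 0"
  unfolding gamma_pos_def by (intro exI[of _ "\<lambda>_. 0"]) simp

lemma gamma_pos_add:
  assumes "gamma_pos m f" "gamma_pos m g"
  shows "gamma_pos m (f + g)"
proof -
  from assms obtain \<gamma> \<delta> where "\<forall>j. \<gamma> j \<ge> 0" "f = (\<Sum>j\<le>m div 2. smult (\<gamma> j) (gamma_basis m j))"
    "\<forall>j. \<delta> j \<ge> 0" "g = (\<Sum>j\<le>m div 2. smult (\<delta> j) (gamma_basis m j))"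
    unfolding gamma_pos_def by blast
  then show ?thesis
    unfolding gamma_pos_def
    by (intro exI[of _ "\<lambda>j. \<gamma> j + \<delta> j"]) (simp add: smult_add_left sum.distrib)
qed

lemma gamma_pos_sum:
  assumes "\<And>x. x \<in> A \<Longrightarrow> gamma_pos m (f x)"
  shows "gamma_pos m (sum f A)"
  using assms by (induction A rule: infinite_finite_induct) (auto simp: gamma_pos_0 gamma_pos_add)

lemma gamma_pos_smult:
  assumes "gamma_pos m f" "c \<ge> 0"
  shows "gamma_pos m (smult c f)"
proof -
  from assms obtain \<gamma> where "\<forall>j. \<gamma> j \<ge> 0" "f = (\<Sum>j\<le>m div 2. smult (\<gamma> j) (gamma_basis m j))"
    unfolding gamma_pos_def by blast
  moreover have "smult c (\<Sum>j\<in>A. g j) = (\<Sum>j\<in>A. smult c (g j))" for g :: "nat \<Rightarrow> real poly" and A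
    by (induction A rule: infinite_finite_induct) (simp_all add: smult_add_right)
  ultimately show ?thesis
    using assms(2) unfolding gamma_pos_def
    by (intro exI[of _ "\<lambda>j. c * \<gamma> j"]) simp
qed

lemma gamma_pos_basis:
  assumes "2 * j \<le> m"
  shows "gamma_pos m (gamma_basis m j)"
  unfolding gamma_pos_def
  using assms by (intro exI[of _ "\<lambda>k. of_bool (k = j)"])
    (auto simp: if_distrib[of "\<lambda>c. smult c _"] of_bool_def cong: if_cong)

lemma gamma_pos_gamma_positive:
  assumes "gamma_pos m f"
  shows "gamma_positive f (real m / 2)"
proof -
  have "{j. real j \<le> real m / 2} = {..m div 2}"
    by auto
  moreover have "nat \<lfloor>2 * (real m / 2) - 2 * real j\<rfloor> = m - 2 * j" for j
    by linarith
  ultimately show ?thesis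
    using assms unfolding gamma_pos_def gamma_positive_def gamma_basis_def by auto
qed

section \<open>Insertion after a non-fixed point, as a differential operator\<close>

definition insert_op :: "nat \<Rightarrow> real poly \<Rightarrow> real poly" where
  "insert_op m f = of_nat m * [:0, 1:] * f + [:0, 1:] * [:1, -1:] * pderiv f"

lemma insert_op_sum: "insert_op m (sum f A) = (\<Sum>x\<in>A. insert_op m (f x))"
proof -
  have "pderiv (sum f A) = (\<Sum>x\<in>A. pderiv (f x))"
    using higher_pderiv_sum[where n = 1] by simp
  then show ?thesis
    unfolding insert_op_def by (simp only: sum_distrib_left sum.distrib)
qed

lemma insert_op_smult: "insert_op m (smult c f) = smult c (insert_op m f)"
  unfolding insert_op_def by (simp add: pderiv_smult smult_add_right)

text \<open>The extra factor p restores the exponent to k, so k = 0 is no exception.\<close>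

lemma times_pderiv_power:
  "(p :: real poly) * pderiv (p ^ k) = of_nat k * p ^ k * pderiv p"
proof (cases k)
  case (Suc l)
  show ?thesis
    unfolding Suc pderiv_power_Suc by (simp add: of_nat_poly mult_ac)
qed simp

text \<open>This is the counting behind the operator: with m non-fixed points of which e are
  excedances, insertion after an excedance keeps the exponent and insertion after any of the other m
  - e raises it by one.\<close>

lemma insert_op_monom:
  assumes "e \<le> m"
  shows "insert_op m (monom 1 e) = of_nat e * monom 1 e + of_nat (m - e) * monom 1 (Suc e)"
proof -
  define t :: "real poly" where "t = [:0, 1:]"
  have t: "monom 1 k = t ^ k" for k
    by (simp add: monom_altdef t_def)
  have d: "t * pderiv (t ^ e) = of_nat e * t ^ e"
    using times_pderiv_power[of t e] by (simp add: t_def pderiv_pCons)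
  have "[:1, -1:] = 1 - t"
    by (simp add: t_def one_pCons)
  then have "insert_op m (monom 1 e) = of_nat m * t * t ^ e + (1 - t) * (t * pderiv (t ^ e))"
    unfolding insert_op_def t t_def[symmetric] by (simp add: mult.assoc mult.left_commute)
  then show ?thesis
    unfolding d t using assms by (simp add: of_nat_diff algebra_simps)
qed

text \<open>Apply the product rule with k = m - 2j and u = 1 + t. The terms with factor j combine by
  2t + (1 - t) = u, those with factor k by u + (1 - t) = 2.\<close>

lemma insert_op_basis:
  assumes "2 * j \<le> m"
  shows "insert_op m (gamma_basis m j) =
    smult (real j) (gamma_basis (Suc m) j) + smult (2 * real (m - 2 * j)) (gamma_basis (Suc m) (Suc j))"
proof -
  define t :: "real poly" where "t = [:0, 1:]"
  define u :: "real poly" where "u = [:1, 1:]"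
  obtain k where k: "m = 2 * j + k"
    using assms le_Suc_ex by blast
  have t: "monom 1 l = t ^ l" for l
    by (simp add: monom_altdef t_def)
  have dt: "t * pderiv (t ^ j) = of_nat j * t ^ j"
    using times_pderiv_power[of t j] by (simp add: t_def pderiv_pCons)
  have du: "pderiv (u ^ k) = of_nat k * u ^ (k - 1)"
    by (simp add: u_def pderiv_power pderiv_pCons of_nat_poly)
  have 1: "[:1, -1:] = 1 - t" and u: "u = 1 + t"
    by (simp_all add: t_def u_def one_pCons)
  have "insert_op m (gamma_basis m j) = of_nat m * t * (t ^ j * u ^ k)
      + (1 - t) * (t * pderiv (t ^ j)) * u ^ k + (1 - t) * t * t ^ j * pderiv (u ^ k)"
    unfolding insert_op_def gamma_basis_def t t_def[symmetric] u_def[symmetric] 1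
    by (simp add: pderiv_mult k algebra_simps)
  also have "\<dots> = of_nat m * t * (t ^ j * u ^ k)
      + (1 - t) * (of_nat j * t ^ j) * u ^ k + (1 - t) * t * t ^ j * (of_nat k * u ^ (k - 1))"
    by (simp only: dt du)
  also have "\<dots> = of_nat j * (t ^ j * u ^ Suc k) + 2 * of_nat k * (t ^ Suc j * u ^ (k - 1))"
  \<comment> \<open>At k = 0 the exponent k - 1 truncates, but its coefficient k vanishes.\<close>
  proof (cases k)
    case 0
    then show ?thesis by (simp add: k u algebra_simps)
  next
    case (Suc l)
    define v where "v = u ^ l"
    have "u ^ k = v + t * v" "u ^ Suc k = v + 2 * t * v + t * t * v" "u ^ (k - 1) = v"
      by (simp_all add: Suc v_def u algebra_simps)
    then show ?thesis
      unfolding k by (simp only:) (simp add: algebra_simps)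
  qed
  also have "\<dots> = smult (real j) (gamma_basis (Suc m) j)
      + smult (2 * real (m - 2 * j)) (gamma_basis (Suc m) (Suc j))"
  proof -
    have "smult (2 * real k) p = 2 * of_nat k * p" for p
      by (simp add: of_nat_poly numeral_poly mult.commute)
    then show ?thesis
      unfolding gamma_basis_def t u_def[symmetric] by (simp add: k of_nat_poly)
  qed
  finally show ?thesis .
qed

lemma gamma_pos_insert_op:
  assumes "gamma_pos m f"
  shows "gamma_pos (Suc m) (insert_op m f)"
proof -
  have basis: "gamma_pos (Suc m) (insert_op m (gamma_basis m j))" if "2 * j \<le> m" for j
  \<comment> \<open>If 2j = m, the index \<open>Suc j\<close> leaves the admissible range, but its
    coefficient m - 2j is 0. Otherwise 2(j + 1) \<le> m + 1.\<close>
  proof (cases "2 * j = m")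
    case True
    then show ?thesis
      by (simp add: insert_op_basis gamma_pos_smult gamma_pos_basis)
  next
    case False
    with that show ?thesis
      by (auto simp: insert_op_basis intro!: gamma_pos_add gamma_pos_smult gamma_pos_basis)
  qed
  from assms obtain \<gamma> where "\<forall>j. \<gamma> j \<ge> 0" "f = (\<Sum>j\<le>m div 2. smult (\<gamma> j) (gamma_basis m j))"
    unfolding gamma_pos_def by blast
  then show ?thesis
    by (auto simp: insert_op_sum insert_op_smult intro!: gamma_pos_sum gamma_pos_smult basis)
qed

text \<open>The factor t shifts j by one while the power of 1 + t must stay, which forces m to grow
  by two.\<close>

lemma gamma_pos_monom_mult:
  assumes "gamma_pos m f"
  shows "gamma_pos (Suc (Suc m)) (monom 1 1 * f)"
proof -
  have "monom 1 1 * gamma_basis m j = gamma_basis (Suc (Suc m)) (Suc j)" for j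
    by (simp add: gamma_basis_def mult_monom flip: mult.assoc)
  moreover from assms obtain \<gamma>
    where "\<forall>j. \<gamma> j \<ge> 0" "f = (\<Sum>j\<le>m div 2. smult (\<gamma> j) (gamma_basis m j))"
    unfolding gamma_pos_def by blast
  ultimately show ?thesis
    by (auto simp: sum_distrib_left intro!: gamma_pos_sum gamma_pos_smult gamma_pos_basis)
qed

section \<open>Inserting a new largest element\<close>

definition nfix :: "nat \<Rightarrow> (nat \<Rightarrow> nat) \<Rightarrow> nat" where
  "nfix n p = card {j \<in> {1..n}. p j = j}"

text \<open>A parity argument lets one recurrence serve both signs. The conditions sit in the
  summand, so that the sum runs over all permutations and can be split by insertion.\<close>

definition exc_poly :: "bool \<Rightarrow> nat \<Rightarrow> nat \<Rightarrow> real poly" where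
  "exc_poly s n i =
    (\<Sum>p | p permutes {1..n}. if evenperm p = s \<and> nfix n p = i then monom 1 (exc n p) else 0)"

lemma exc_poly_eq_0:
  assumes "i > n"
  shows "exc_poly s n i = 0"
proof -
  have "nfix n p \<le> card {1..n}" for p
    unfolding nfix_def by (rule card_mono) auto
  then show ?thesis
    unfolding exc_poly_def using assms by (intro sum.neutral) (auto dest: leD)
qed

lemma nfix_Suc:
  assumes "q permutes {1..n}"
  shows "nfix (Suc n) q = Suc (nfix n q)"
proof -
  have "q (Suc n) = Suc n"
    using assms by (auto simp: permutes_def)
  then have "{j \<in> {1..Suc n}. q j = j} = insert (Suc n) {j \<in> {1..n}. q j = j}"
    by (auto simp: le_Suc_eq)
  then show ?thesis
    by (simp add: nfix_def)
qed

lemma exc_Suc: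
  assumes "q permutes {1..n}"
  shows "exc (Suc n) q = exc n q"
proof -
  have "q (Suc n) = Suc n"
    using assms by (auto simp: permutes_def)
  then have "{j \<in> {1..Suc n}. q j > j} = {j \<in> {1..n}. q j > j}"
    by (auto simp: le_Suc_eq)
  then show ?thesis
    by (simp add: exc_def)
qed

text \<open>The composite sends j to n + 1 and n + 1 to q j. So j becomes an excedance and is no
  longer fixed, n + 1 is neither fixed nor an excedance, and all other positions are
  unchanged.\<close>

lemma
  assumes q: "q permutes {1..n}" and j: "j \<in> {1..n}"
  shows nfix_insert: "nfix (Suc n) (q \<circ> transpose (Suc n) j) = nfix n q - of_bool (q j = j)"
    and exc_insert: "exc (Suc n) (q \<circ> transpose (Suc n) j) = exc n q + of_bool (\<not> j < q j)"
    and evenperm_insert: "evenperm (q \<circ> transpose (Suc n) j) = (\<not> evenperm q)"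
proof -
  have Suc: "q (Suc n) = Suc n"
    using q by (auto simp: permutes_def)
  have ran: "q x \<in> {1..n} \<longleftrightarrow> x \<in> {1..n}" for x
    using permutes_in_image[OF q] .
  have "{x \<in> {1..Suc n}. (q \<circ> transpose (Suc n) j) x = x} = {x \<in> {1..n}. q x = x} - {j}"
    using j ran[of j] by (auto simp: Suc transpose_def le_Suc_eq split: if_splits)
  then show "nfix (Suc n) (q \<circ> transpose (Suc n) j) = nfix n q - of_bool (q j = j)"
    using j by (simp add: nfix_def card_Diff_singleton_if)
  have "{x \<in> {1..Suc n}. (q \<circ> transpose (Suc n) j) x > x} = insert j {x \<in> {1..n}. q x > x}"
    using j ran[of j] by (auto simp: Suc transpose_def le_Suc_eq split: if_splits)
  then show "exc (Suc n) (q \<circ> transpose (Suc n) j) = exc n q + of_bool (\<not> j < q j)"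
    using j by (auto simp: exc_def card_insert_if)
  have "permutation q"
    using q by (auto simp: permutation_permutes)
  then show "evenperm (q \<circ> transpose (Suc n) j) = (\<not> evenperm q)"
    using j by (auto simp: evenperm_comp permutation_swap_id evenperm_swap)
qed

text \<open>Permutations are first split by the image b of n + 1, with the transposition on the
  left; b = n + 1 gives the term f q. Conjugation by q moves the transposition to the right, and b =
  q j reindexes the rest by the preimage j of n + 1.\<close>

lemma sum_permutes_Suc:
  fixes f :: "(nat \<Rightarrow> nat) \<Rightarrow> 'a :: comm_monoid_add"
  shows "(\<Sum>p | p permutes {1..Suc n}. f p) =
    (\<Sum>q | q permutes {1..n}. f q + (\<Sum>j\<in>{1..n}. f (q \<circ> transpose (Suc n) j)))"
proof -
  have ins: "{1..Suc n} = insert (Suc n) {1..n}"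
    by auto
  have "(\<Sum>p | p permutes {1..Suc n}. f p) =
      (\<Sum>b\<in>insert (Suc n) {1..n}. \<Sum>q | q permutes {1..n}. f (transpose (Suc n) b \<circ> q))"
    unfolding ins by (rule sum_over_permutations_insert) auto
  also have "\<dots> = (\<Sum>q | q permutes {1..n}. \<Sum>b\<in>insert (Suc n) {1..n}. f (transpose (Suc n) b \<circ> q))"
    by (rule sum.swap)
  also have "\<dots> = (\<Sum>q | q permutes {1..n}. f q + (\<Sum>j\<in>{1..n}. f (q \<circ> transpose (Suc n) j)))"
  proof (rule sum.cong[OF refl])
    fix q assume "q \<in> {q. q permutes {1..n}}"
    then have q: "q permutes {1..n}"
      by simp
    have "inv q (Suc n) = Suc n" "inv q (q j) = j" for j
      using permutes_not_in[OF permutes_inv[OF q]] permutes_inverses(2)[OF q] by simp_all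
    then have "transpose (Suc n) (q j) \<circ> q = q \<circ> transpose (Suc n) j" for j
      using transpose_comp_eq[OF permutes_bij[OF q], of "Suc n" "q j"] by simp
    then have "(\<Sum>b\<in>{1..n}. f (transpose (Suc n) b \<circ> q)) = (\<Sum>j\<in>{1..n}. f (q \<circ> transpose (Suc n) j))"
      using sum.permute[OF q, of "\<lambda>b. f (transpose (Suc n) b \<circ> q)"] by (simp add: comp_def[of _ q])
    then show "(\<Sum>b\<in>insert (Suc n) {1..n}. f (transpose (Suc n) b \<circ> q)) =
        f q + (\<Sum>j\<in>{1..n}. f (q \<circ> transpose (Suc n) j))"
      by simp
  qed
  finally show ?thesis .
qed

lemma card_exc_compl:
  "card {j \<in> {1..n}. q j < j} = n - nfix n q - exc n q" "nfix n q + exc n q \<le> n"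
proof -
  define A where "A = {j \<in> {1..n}. q j < j}"
  define B where "B = {j \<in> {1..n}. q j = j}"
  define C where "C = {j \<in> {1..n}. q j > j}"
  have "{1..n} = A \<union> (B \<union> C)" "A \<inter> (B \<union> C) = {}" "B \<inter> C = {}" "finite A" "finite B" "finite C"
    unfolding A_def B_def C_def by auto
  then have "card {1..n} = card A + (card B + card C)"
    by (simp only: card_Un_disjoint finite_Un)
  then have "n = card {j \<in> {1..n}. q j < j} + (nfix n q + exc n q)"
    by (simp only: card_atLeastAtMost diff_Suc_1 A_def B_def C_def nfix_def exc_def)
  then show "card {j \<in> {1..n}. q j < j} = n - nfix n q - exc n q" "nfix n q + exc n q \<le> n"
    by linarith+
qed

lemma sum_insert:
  fixes s :: bool and n i :: nat
  defines "w \<equiv> \<lambda>s n i p. if evenperm p = s \<and> nfix n p = i then monom 1 (exc n p) else (0 :: real poly)"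
  assumes q: "q permutes {1..n}"
  shows "(\<Sum>j\<in>{1..n}. w s (Suc n) i (q \<circ> transpose (Suc n) j)) =
    insert_op (n - i) (w (\<not> s) n i q) + of_nat (Suc i) * (monom 1 1 * w (\<not> s) n (Suc i) q)"
proof -
  \<comment> \<open>Insertion after a fixed point destroys it, so it yields i fixed points only from
    q with i + 1 of them; the exponent rises by one. \<open>?b\<close> selects the q that already
    have i.\<close>
  let ?X = "of_bool (evenperm q = (\<not> s) \<and> nfix n q = Suc i) * monom 1 (Suc (exc n q)) :: real poly"
  let ?b = "of_bool (evenperm q = (\<not> s) \<and> nfix n q = i) :: real poly"
  \<comment> \<open>Guards the truncated subtraction in \<open>nfix_insert\<close>: without it, 0 -
    1 = 0 would look like a match for i = 0.\<close>
  have pos: "0 < nfix n q" if "j \<in> {1..n}" "q j = j" for j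
    using that unfolding nfix_def by (auto simp: card_gt_0_iff)
  have "(\<Sum>j\<in>{1..n}. w s (Suc n) i (q \<circ> transpose (Suc n) j)) =
     (\<Sum>j\<in>{1..n}. of_bool (q j = j) * ?X + of_bool (j < q j) * (?b * monom 1 (exc n q))
        + of_bool (q j < j) * (?b * monom 1 (Suc (exc n q))))"
  proof (rule sum.cong[OF refl])
    fix j assume j: "j \<in> {1..n}"
    consider "q j = j" | "j < q j" | "q j < j"
      by linarith
    then show "w s (Suc n) i (q \<circ> transpose (Suc n) j) =
      of_bool (q j = j) * ?X + of_bool (j < q j) * (?b * monom 1 (exc n q))
        + of_bool (q j < j) * (?b * monom 1 (Suc (exc n q)))"
      using pos[OF j]
      by cases (auto simp: w_def nfix_insert[OF q j] exc_insert[OF q j] evenperm_insert[OF q j])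
  qed
  also have "\<dots> = of_nat (nfix n q) * ?X + of_nat (exc n q) * (?b * monom 1 (exc n q))
      + of_nat (n - nfix n q - exc n q) * (?b * monom 1 (Suc (exc n q)))"
    unfolding card_exc_compl(1)[symmetric]
    by (simp only: sum.distrib sum_distrib_right[symmetric])
       (simp add: nfix_def exc_def Int_def)
  \<comment> \<open>For \<open>nfix n q = i\<close> the first and last counts are those of
    \<open>insert_op_monom\<close> with m = n - i, once the vanishing fixed-point term is dropped:
    \<open>exc n q\<close> excedances and m - \<open>exc n q\<close> positions with q j < j.\<close>
  also have "\<dots> = insert_op (n - i) (w (\<not> s) n i q)
      + of_nat (Suc i) * (monom 1 1 * w (\<not> s) n (Suc i) q)"
    using card_exc_compl(2)[of n q]
    by (auto simp: w_def insert_op_monom mult_monom) (simp_all add: insert_op_def)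
  finally show ?thesis .
qed

section \<open>The recurrence and the induction\<close>

lemma exc_poly_Suc:
  "exc_poly s (Suc n) i = (if i = 0 then 0 else exc_poly s n (i - 1))
    + insert_op (n - i) (exc_poly (\<not> s) n i) + of_nat (Suc i) * (monom 1 1 * exc_poly (\<not> s) n (Suc i))"
proof -
  \<comment> \<open>Fixing n + 1 contributes a fixed point, so this term is absent for i = 0, where
    i - 1 would truncate.\<close>
  have "(if evenperm q = s \<and> nfix (Suc n) q = i then monom 1 (exc (Suc n) q) else 0) =
      (if i = 0 then 0 else
        if evenperm q = s \<and> nfix n q = i - 1 then monom 1 (exc n q) else (0 :: real poly))"
    if "q permutes {1..n}" for q
    using that by (auto simp: nfix_Suc exc_Suc)
  then have "exc_poly s (Suc n) i =
    (\<Sum>q | q permutes {1..n}. (if i = 0 then 0 else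
        if evenperm q = s \<and> nfix n q = i - 1 then monom 1 (exc n q) else 0) +
      (insert_op (n - i) (if evenperm q = (\<not> s) \<and> nfix n q = i then monom 1 (exc n q) else 0)
      + of_nat (Suc i) *
        (monom 1 1 * (if evenperm q = (\<not> s) \<and> nfix n q = Suc i then monom 1 (exc n q) else 0))))"
    unfolding exc_poly_def sum_permutes_Suc
    by (intro sum.cong refl) (simp only: mem_Collect_eq sum_insert)
  then show ?thesis
    unfolding exc_poly_def
    by (simp only: sum.distrib insert_op_sum sum_distrib_left add.assoc) simp
qed

text \<open>All three terms of the recurrence share one centre: n - (i - 1), (n - i) + 1 and (n - (i
  + 1)) + 2 agree. Parity and i vary in the induction because the recurrence changes both.\<close>

lemma gamma_pos_exc_poly:
  assumes "i \<le> n"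
  shows "gamma_pos (n - i) (exc_poly s n i)"
  using assms
proof (induction n arbitrary: s i)
  case 0
  \<comment> \<open>The only permutation of the empty set is the identity, which is even; the odd
    polynomial is 0.\<close>
  have "gamma_basis 0 0 = 1"
    by (simp add: gamma_basis_def)
  then have "exc_poly s 0 0 = (if s then gamma_basis 0 0 else 0)"
    by (simp add: exc_poly_def nfix_def exc_def evenperm_id)
  with 0 show ?case
    using gamma_pos_basis[of 0 0] by (simp add: gamma_pos_0)
next
  case (Suc n)
  have "gamma_pos (Suc n - i) (if i = 0 then 0 else exc_poly s n (i - 1))"
    using Suc.IH[of "i - 1" s] Suc.prems by (cases i) (simp_all add: gamma_pos_0)
  moreover have "gamma_pos (Suc n - i) (insert_op (n - i) (exc_poly (\<not> s) n i))"
  proof (cases "i \<le> n")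
    case True
    then show ?thesis
      using gamma_pos_insert_op[OF Suc.IH[OF True]] by (simp add: Suc_diff_le)
  next
    \<comment> \<open>Here i = n + 1, more fixed points than a permutation of {1..n} can
      have.\<close>
    case False
    then show ?thesis
      by (simp add: exc_poly_eq_0 insert_op_def gamma_pos_0)
  qed
  moreover have "gamma_pos (Suc n - i) (monom 1 1 * exc_poly (\<not> s) n (Suc i))"
  proof (cases "Suc i \<le> n")
    case True
    then have "Suc n - i = Suc (Suc (n - Suc i))"
      by simp
    then show ?thesis
      using gamma_pos_monom_mult[OF Suc.IH[OF True]] by simp
  next
    case False
    then show ?thesis
      by (simp add: exc_poly_eq_0 gamma_pos_0)
  qed
  then have "gamma_pos (Suc n - i) (of_nat (Suc i) * (monom 1 1 * exc_poly (\<not> s) n (Suc i)))"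
    using gamma_pos_smult[of _ _ "real (Suc i)"] by (simp add: of_nat_poly del: of_nat_Suc)
  ultimately show ?case
    unfolding exc_poly_Suc by (intro gamma_pos_add)
qed

lemma exc_poly_eq_ADerExc:
  "exc_poly True n i = ADerExc_plus n i" "exc_poly False n i = ADerExc_minus n i"
proof -
  have "SD_plus n i = {p. p permutes {1..n}} \<inter> {p. evenperm p \<and> nfix n p = i}"
    "SD_minus n i = {p. p permutes {1..n}} \<inter> {p. \<not> evenperm p \<and> nfix n p = i}"
    by (auto simp: SD_plus_def SD_minus_def SD_def alternating_perms_def symmetric_perms_def nfix_def)
  then show "exc_poly True n i = ADerExc_plus n i" "exc_poly False n i = ADerExc_minus n i"
    by (simp_all add: exc_poly_def ADerExc_plus_def ADerExc_minus_def sum.If_cases finite_permutations)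
qed

theorem theorem43:
  fixes n i :: nat
  assumes "n \<ge> 1" and "i \<le> n"
  shows "gamma_positive (ADerExc_plus n i) ((real n - real i) / 2) \<and>
         gamma_positive (ADerExc_minus n i) ((real n - real i) / 2)"
  using gamma_pos_gamma_positive[OF gamma_pos_exc_poly[OF assms(2)]] assms(2)
  by (auto simp: of_nat_diff simp flip: exc_poly_eq_ADerExc)

end
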